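(* Let $\varepsilon\in\mathbb{R}$. The linear map $\Phi:\mathbb{R}^5\to\mathfrak{se}^*(2)\times\mathbb{R}^2$ given by $$\Phi(x_1,x_2,x_3,x_4,x_5)=(x_1,x_2,x_3,x_4,\varepsilon x_3+x_5)$$ is a Poisson diffeomorphism between $(\mathbb{R}^5,\{\cdot,\cdot\}_1)$ and $(\mathfrak{se}^*(2)\times\mathbb{R}^2,\{\cdot,\cdot\}_2)$.
   Context: The bracket $\{\cdot,\cdot\}_1$ on smooth functions on $\mathbb{R}^5$ with coordinates $(x_1,\dots,x_5)$ is $$\{f,g\}_1=x_1\left[\left(\frac{\partial f}{\partial x_2}\frac{\partial g}{\partial x_3}-\frac{\partial f}{\partial x_3}\frac{\partial g}{\partial x_2}\right)+\varepsilon\left(\frac{\partial f}{\partial x_5}\frac{\partial g}{\partial x_2}-\frac{\partial f}{\partial x_2}\frac{\partial g}{\partial x_5}\right)\right]$$ $$\quad+x_2\left[\left(\frac{\partial f}{\partial x_3}\frac{\partial g}{\partial x_1}-\frac{\partial f}{\partial x_1}\frac{\partial g}{\partial x_3}\right)+\varepsilon\left(\frac{\partial f}{\partial x_1}\frac{\partial g}{\partial x_5}-\frac{\partial f}{\partial x_5}\frac{\partial g}{\partial x_1}\right)\right]+\frac{\partial f}{\partial x_5}\frac{\partial g}{\partial x_4}-\frac{\partial f}{\partial x_4}\frac{\partial g}{\partial x_5}.$$ The space $\mathfrak{se}^*(2)$ (dual of the Lie algebra of the Euclidean group of the plane) is identified with $\mathbb{R}^3$ with coordinates $(\mu_1,\mu_2,\mu_3)$,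 and $\mathbb{R}^2$ has coordinates $(u_1,u_2)$. The bracket $\{\cdot,\cdot\}_2$ on $\mathfrak{se}^*(2)\times\mathbb{R}^2$ (product of the Lie-Poisson bracket and the standard symplectic bracket) is $$\{f,g\}_2=\mu_1\left(\frac{\partial f}{\partial\mu_2}\frac{\partial g}{\partial\mu_3}-\frac{\partial f}{\partial\mu_3}\frac{\partial g}{\partial\mu_2}\right)+\mu_2\left(\frac{\partial f}{\partial\mu_3}\frac{\partial g}{\partial\mu_1}-\frac{\partial f}{\partial\mu_1}\frac{\partial g}{\partial\mu_3}\right)+\frac{\partial f}{\partial u_2}\frac{\partial g}{\partial u_1}-\frac{\partial f}{\partial u_1}\frac{\partial g}{\partial u_2}.$$ The components of $\Phi$ are the coordinates $(\mu_1,\mu_2,\mu_3,u_1,u_2)$ in this order. A Poisson diffeomorphism is a diffeomorphism $\Phi$ with $\{f\circ\Phi,g\circ\Phi\}_1=\{f,g\}_2\circ\Phi$ for all smooth $f,g$. *)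

theory Defs
  imports "HOL-Analysis.Analysis"
begin

primrec C_k :: "nat \<Rightarrow> ('a::euclidean_space \<Rightarrow> 'b::euclidean_space) \<Rightarrow> bool" where
  "C_k 0 f \<longleftrightarrow> continuous_on UNIV f"
| "C_k (Suc k) f \<longleftrightarrow>
     (\<forall>x. f differentiable (at x)) \<and> (\<forall>v. C_k k (\<lambda>x. frechet_derivative f (at x) v))"

definition smooth :: "('a::euclidean_space \<Rightarrow> 'b::euclidean_space) \<Rightarrow> bool" where
  "smooth f \<longleftrightarrow> (\<forall>k. C_k k f)"

definition diffeomorphism :: "('a::euclidean_space \<Rightarrow> 'b::euclidean_space) \<Rightarrow> bool" where
  "diffeomorphism \<Phi> \<longleftrightarrow> bij \<Phi> \<and> smooth \<Phi> \<and> smooth (inv \<Phi>)"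

definition dir_deriv :: "'a::euclidean_space \<Rightarrow> ('a \<Rightarrow> real) \<Rightarrow> 'a \<Rightarrow> real" where
  "dir_deriv v f x = deriv (\<lambda>t. f (x + t *\<^sub>R v)) 0"

type_synonym 'a bracket = "('a \<Rightarrow> real) \<Rightarrow> ('a \<Rightarrow> real) \<Rightarrow> 'a \<Rightarrow> real"

definition poisson_diffeomorphism ::
    "'a::euclidean_space bracket \<Rightarrow> 'b::euclidean_space bracket \<Rightarrow> ('a \<Rightarrow> 'b) \<Rightarrow> bool" where
  "poisson_diffeomorphism B B' \<Phi> \<longleftrightarrow>
     diffeomorphism \<Phi> \<and>
     (\<forall>f g. smooth f \<longrightarrow> smooth g \<longrightarrow> B (f \<circ> \<Phi>) (g \<circ> \<Phi>) = B' f g \<circ> \<Phi>)"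

(* The index type 5 is arithmetic modulo 5, so its elements are 1, ..., 4 and 5 = 0. *)
definition dx :: "5 \<Rightarrow> (real^5 \<Rightarrow> real) \<Rightarrow> real^5 \<Rightarrow> real" where
  "dx i = dir_deriv (axis i 1)"

definition bracket1 :: "real \<Rightarrow> (real^5) bracket" where
  "bracket1 \<epsilon> f g x =
     x$1 * ((dx 2 f x * dx 3 g x - dx 3 f x * dx 2 g x)
            + \<epsilon> * (dx 5 f x * dx 2 g x - dx 2 f x * dx 5 g x))
   + x$2 * ((dx 3 f x * dx 1 g x - dx 1 f x * dx 3 g x)
            + \<epsilon> * (dx 1 f x * dx 5 g x - dx 5 f x * dx 1 g x))
   + dx 5 f x * dx 4 g x - dx 4 f x * dx 5 g x"

(* The dual of se(2) in the coordinates (mu_1, mu_2, mu_3). *)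
type_synonym se2_dual = "real^3"

definition d\<mu> :: "3 \<Rightarrow> (se2_dual \<times> (real^2) \<Rightarrow> real) \<Rightarrow> se2_dual \<times> (real^2) \<Rightarrow> real" where
  "d\<mu> i = dir_deriv (axis i 1, 0)"

definition du :: "2 \<Rightarrow> (se2_dual \<times> (real^2) \<Rightarrow> real) \<Rightarrow> se2_dual \<times> (real^2) \<Rightarrow> real" where
  "du j = dir_deriv (0, axis j 1)"

definition bracket2 :: "(se2_dual \<times> (real^2)) bracket" where
  "bracket2 f g p =
     fst p $ 1 * (d\<mu> 2 f p * d\<mu> 3 g p - d\<mu> 3 f p * d\<mu> 2 g p)
   + fst p $ 2 * (d\<mu> 3 f p * d\<mu> 1 g p - d\<mu> 1 f p * d\<mu> 3 g p)
   + du 2 f p * du 1 g p - du 1 f p * du 2 g p"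

definition Phi :: "real \<Rightarrow> real^5 \<Rightarrow> se2_dual \<times> (real^2)" where
  "Phi \<epsilon> x = (vector [x$1, x$2, x$3], vector [x$4, \<epsilon> * x$3 + x$5])"

end

theory Submission imports Defs begin

text \<open>
  Since \<open>\<Phi> = Phi \<epsilon>\<close> is linear, the derivative of \<open>f \<circ> \<Phi>\<close> at \<open>x\<close> along \<open>v\<close> is the
  derivative of \<open>f\<close> at \<open>\<Phi> x\<close> along \<open>\<Phi> v\<close> (\<open>dir_deriv_comp_linear\<close>). The coordinate vectors
  are mapped to coordinate vectors, except that \<open>\<partial>/\<partial>x\<^sub>3\<close> is sent to
  \<open>\<partial>/\<partial>\<mu>\<^sub>3 + \<epsilon> \<partial>/\<partial>u\<^sub>2\<close>. In the first bracket this produces \<open>\<epsilon>\<close>-multiples of the products of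
  \<open>\<partial>/\<partial>u\<^sub>2\<close> with \<open>\<partial>/\<partial>\<mu>\<^sub>1\<close> and \<open>\<partial>/\<partial>\<mu>\<^sub>2\<close>; they are exactly the negatives of the explicit
  \<open>\<epsilon>\<close>-terms of that bracket, so that only the product bracket is left.

  Smoothness in both directions holds because \<open>\<Phi>\<close> has an explicit linear inverse
  (\<open>Phi_inv\<close>), and a linear map has constant derivatives.
\<close>

section \<open>Smoothness of linear maps\<close>

lemma C_k_const: "C_k k (\<lambda>x::'a::euclidean_space. c::'b::euclidean_space)"
  by (induction k arbitrary: c) auto

lemma linear_imp_smooth:
  fixes L :: "'a::euclidean_space \<Rightarrow> 'b::euclidean_space"
  assumes "linear L"
  shows "smooth L"
proof -
  have deriv: "(L has_derivative L) (at x)" for x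
    using assms by (simp add: linear_conv_bounded_linear bounded_linear_imp_has_derivative)
  have "C_k k L" for k
  proof (cases k)
    case 0
    then show ?thesis
      using assms by (simp add: linear_continuous_on linear_conv_bounded_linear)
  next
    case (Suc m)
    have "frechet_derivative L (at x) = L" for x
      using frechet_derivative_at[OF deriv] by simp
    then show ?thesis
      using deriv Suc by (auto simp: C_k_const differentiable_def)
  qed
  then show ?thesis
    by (simp add: smooth_def)
qed

lemma smooth_imp_differentiable:
  assumes "smooth f"
  shows "f differentiable (at x)"
proof -
  have "C_k (Suc 0) f"
    using assms by (simp only: smooth_def)
  then show ?thesis
    by simp
qed

section \<open>Directional derivatives\<close>

text \<open>
  \<open>L\<close> maps the line through \<open>x\<close> in direction \<open>v\<close> to the line through \<open>L x\<close> in
  direction \<open>L v\<close>, with the same parameter: both sides differentiate the same function of one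
  variable.
\<close>
lemma dir_deriv_comp_linear:
  assumes "linear L"
  shows "dir_deriv v (f \<circ> L) x = dir_deriv (L v) f (L x)"
  using assms by (simp add: dir_deriv_def linear_add linear_scale)

lemma dir_deriv_eq_frechet_derivative:
  assumes "f differentiable (at x)"
  shows "dir_deriv v f x = frechet_derivative f (at x) v"
proof -
  let ?D = "frechet_derivative f (at x)"
  have D: "(f has_derivative ?D) (at (x + 0 *\<^sub>R v))"
    using assms by (simp add: frechet_derivative_works)
  have "((\<lambda>t. x + t *\<^sub>R v) has_derivative (\<lambda>t. t *\<^sub>R v)) (at 0)"
    by (auto intro!: derivative_eq_intros)
  from has_derivative_compose[OF this D]
  have "((\<lambda>t. f (x + t *\<^sub>R v)) has_derivative (\<lambda>t. ?D (t *\<^sub>R v))) (at 0)" .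
  moreover have "(\<lambda>t. ?D (t *\<^sub>R v)) = (*) (?D v)"
    using linear_frechet_derivative[OF assms] by (auto simp: linear_scale mult.commute)
  ultimately show ?thesis
    by (simp add: dir_deriv_def has_field_derivative_def DERIV_imp_deriv)
qed

lemma dir_deriv_add_scale:
  assumes "f differentiable (at x)"
  shows "dir_deriv (v + c *\<^sub>R w) f x = dir_deriv v f x + c * dir_deriv w f x"
  using assms linear_frechet_derivative[OF assms]
  by (simp add: dir_deriv_eq_frechet_derivative linear_add linear_scale)

section \<open>The map and its inverse\<close>

lemma exhaust_5:
  fixes i :: 5
  shows "i = 1 \<or> i = 2 \<or> i = 3 \<or> i = 4 \<or> i = 5"
proof (induct i)
  case (of_int z)
  \<comment> \<open>the representatives run from 0 to 4, and 0 is the index 5\<close>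
  then have "z = 0 \<or> z = 1 \<or> z = 2 \<or> z = 3 \<or> z = 4"
    by fastforce
  then show ?case
    by auto
qed

lemma vec_eq_iff_5:
  fixes x y :: "'a^5"
  shows "x = y \<longleftrightarrow> x$1 = y$1 \<and> x$2 = y$2 \<and> x$3 = y$3 \<and> x$4 = y$4 \<and> x$5 = y$5"
  unfolding vec_eq_iff by (metis exhaust_5)

lemma linear_Phi: "linear (Phi \<epsilon>)"
  by (rule linearI)
    (simp_all add: Phi_def vec_eq_iff forall_3 forall_2 algebra_simps)

definition Phi_inv :: "real \<Rightarrow> se2_dual \<times> (real^2) \<Rightarrow> real^5" where
  "Phi_inv \<epsilon> p = vector [fst p $ 1, fst p $ 2, fst p $ 3, snd p $ 1, snd p $ 2 - \<epsilon> * fst p $ 3]"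

lemma vector_5:
  "(vector [a, b, c, d, e] :: 'a::zero^5) $ 1 = a"
  "(vector [a, b, c, d, e] :: 'a::zero^5) $ 2 = b"
  "(vector [a, b, c, d, e] :: 'a::zero^5) $ 3 = c"
  "(vector [a, b, c, d, e] :: 'a::zero^5) $ 4 = d"
  "(vector [a, b, c, d, e] :: 'a::zero^5) $ 5 = e"
  by (simp_all add: vector_def)

lemma linear_Phi_inv: "linear (Phi_inv \<epsilon>)"
  by (rule linearI) (simp_all add: Phi_inv_def vec_eq_iff_5 vector_5 algebra_simps)

lemma Phi_inv_Phi: "Phi_inv \<epsilon> (Phi \<epsilon> x) = x"
  by (simp add: Phi_def Phi_inv_def vec_eq_iff_5 vector_5)

lemma Phi_Phi_inv: "Phi \<epsilon> (Phi_inv \<epsilon> p) = p"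
  by (simp add: Phi_def Phi_inv_def vector_5 prod_eq_iff vec_eq_iff forall_3 forall_2)

lemma diffeomorphism_Phi: "diffeomorphism (Phi \<epsilon>)"
proof -
  have "bij (Phi \<epsilon>)"
    by (rule o_bij[of "Phi_inv \<epsilon>"]) (auto simp: Phi_inv_Phi Phi_Phi_inv)
  moreover have "inv (Phi \<epsilon>) = Phi_inv \<epsilon>"
    by (rule inv_unique_comp) (auto simp: Phi_inv_Phi Phi_Phi_inv)
  ultimately show ?thesis
    by (simp add: diffeomorphism_def linear_imp_smooth linear_Phi linear_Phi_inv)
qed

section \<open>Comparison of the brackets\<close>

lemma Phi_axis:
  "Phi \<epsilon> (axis 1 1) = (axis 1 1, 0)"
  "Phi \<epsilon> (axis 2 1) = (axis 2 1, 0)"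
  "Phi \<epsilon> (axis 3 1) = (axis 3 1, 0) + \<epsilon> *\<^sub>R (0, axis 2 1)"
  "Phi \<epsilon> (axis 4 1) = (0, axis 1 1)"
  "Phi \<epsilon> (axis 5 1) = (0, axis 2 1)"
  by (simp_all add: Phi_def axis_def vec_eq_iff forall_3 forall_2)

lemma dx_comp_Phi:
  "dx 1 (f \<circ> Phi \<epsilon>) x = d\<mu> 1 f (Phi \<epsilon> x)"
  "dx 2 (f \<circ> Phi \<epsilon>) x = d\<mu> 2 f (Phi \<epsilon> x)"
  "dx 4 (f \<circ> Phi \<epsilon>) x = du 1 f (Phi \<epsilon> x)"
  "dx 5 (f \<circ> Phi \<epsilon>) x = du 2 f (Phi \<epsilon> x)"
  by (simp_all only: dx_def d\<mu>_def du_def dir_deriv_comp_linear[OF linear_Phi] Phi_axis)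

text \<open>
  Here \<open>f\<close> is differentiated along a sum of two coordinate vectors. That this splits into two
  partial derivatives is where differentiability of \<open>f\<close> is used.
\<close>
lemma dx_3_comp_Phi:
  assumes "f differentiable (at (Phi \<epsilon> x))"
  shows "dx 3 (f \<circ> Phi \<epsilon>) x = d\<mu> 3 f (Phi \<epsilon> x) + \<epsilon> * du 2 f (Phi \<epsilon> x)"
  by (simp only: dx_def d\<mu>_def du_def dir_deriv_comp_linear[OF linear_Phi] Phi_axis
      dir_deriv_add_scale[OF assms])

lemma bracket1_comp_Phi:
  assumes "f differentiable (at (Phi \<epsilon> x))" "g differentiable (at (Phi \<epsilon> x))"
  shows "bracket1 \<epsilon> (f \<circ> Phi \<epsilon>) (g \<circ> Phi \<epsilon>) x = bracket2 f g (Phi \<epsilon> x)"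
proof -
  have "fst (Phi \<epsilon> x) $ 1 = x $ 1" "fst (Phi \<epsilon> x) $ 2 = x $ 2"
    by (simp_all add: Phi_def)
  then show ?thesis
    by (simp only: bracket1_def bracket2_def dx_comp_Phi dx_3_comp_Phi[OF assms(1)]
        dx_3_comp_Phi[OF assms(2)]) (simp add: algebra_simps)
qed

theorem mainTheorem2:
  fixes \<epsilon> :: real
  shows "linear (Phi \<epsilon>) \<and> poisson_diffeomorphism (bracket1 \<epsilon>) bracket2 (Phi \<epsilon>)"
proof -
  have "bracket1 \<epsilon> (f \<circ> Phi \<epsilon>) (g \<circ> Phi \<epsilon>) = bracket2 f g \<circ> Phi \<epsilon>"
    if "smooth f" "smooth g" for f g
  proof
    fix x
    show "bracket1 \<epsilon> (f \<circ> Phi \<epsilon>) (g \<circ> Phi \<epsilon>) x = (bracket2 f g \<circ> Phi \<epsilon>) x"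
      using that by (simp add: bracket1_comp_Phi smooth_imp_differentiable)
  qed
  then show ?thesis
    by (simp add: linear_Phi poisson_diffeomorphism_def diffeomorphism_Phi)
qed

end
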